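(* Let $K\subseteq\mathbb{R}^d$ be a convex body whose affine span $\operatorname{aff}(K)$ contains a lattice point, and let $\ell_c:\mathbb{Z}^d\to\mathbb{Z}$, $\ell_c(x)=c^Tx$, be a linear functional given by some $c\in\mathbb{Z}^d$. Then there exist a step size $\lambda$, a left bound $t$ and a right bound $t'$, depending only on $K$ (and the fixed functional $\ell_c$), and in particular not on $n$, such that for all sufficiently large positive integers $n$ the arithmetic range $\mathrm{AR}_c(nK)$ is an almost arithmetic progression with step size $\lambda$, left bound $t$ and right bound $t'$.
   Context: A convex body is a compact convex subset of $\mathbb{R}^d$ (it need not have nonempty interior). For a convex body $K$ and $c\in\mathbb{Z}^d$, the arithmetic range of $K$ with respect to $\ell_c(x)=c^Tx$ is $\mathrm{AR}_c(K)=\{n\in\mathbb{Z}: n=\ell_c(x)\text{ for some }x\in K\cap\mathbb{Z}^d\}$. A finite nonempty set $S\subset\mathbb{Z}$ is an almost arithmetic progression with step size $\lambda$, left bound $t$ and right bound $t'$ if, writing $m=\min S$ and $M=\max S$, we have $S=\{m,m+\lambda,\dots,M-\lambda,M\}\setminus(A\cup A')$ for some $A\subseteq[m,m+t]\cap(\lambda\mathbb{Z}+m)$ and $A'\subseteq[M-t',M]\cap(\lambda\mathbb{Z}+m)$; equivalently $(\lambda\mathbb{Z}+m)\supseteq S\supseteq[m+t,M-t']\cap(\lambda\mathbb{Z}+m)$.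
   Formalization: The arithmetic range can be empty for all n (segment from (1,u) to (2,2u), u irrational), hence no almost arithmetic progression; the claim is therefore made for those large n where the range is nonempty, and for all large n if aff(K) is spanned by its lattice points. *)

theory Defs
  imports "HOL-Analysis.Analysis"
begin

definition real_vec :: "int ^ 'd \<Rightarrow> real ^ 'd" where
  "real_vec x = (\<chi> i. real_of_int (x $ i))"

abbreviation integer_lattice :: "(real ^ 'd) set" where
  "integer_lattice \<equiv> range real_vec"

definition lin_fun :: "int ^ 'd \<Rightarrow> int ^ 'd \<Rightarrow> int" where
  "lin_fun c x = (\<Sum>i\<in>UNIV. c $ i * x $ i)"

definition arith_range :: "int ^ 'd \<Rightarrow> (real ^ 'd) set \<Rightarrow> int set" where
  "arith_range c K = {n. \<exists>x. real_vec x \<in> K \<and> n = lin_fun c x}"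

text \<open>
  The term \<open>range (\<lambda>k. m + s * k)\<close> is the coset $s\mathbb{Z} + m$, and the progression
  $\{m, m + s, \ldots, M\}$ is its intersection with $[m, M]$. Only nonempty sets qualify,
  and the step size is positive.
\<close>

definition almost_arith_prog :: "int \<Rightarrow> int \<Rightarrow> int \<Rightarrow> int set \<Rightarrow> bool" where
  "almost_arith_prog s t t' S \<longleftrightarrow>
     s > 0 \<and> finite S \<and> S \<noteq> {} \<and>
     (let m = Min S; M = Max S; P = range (\<lambda>k. m + s * k) in
      \<exists>A A'. A \<subseteq> {m..m + t} \<inter> P \<and> A' \<subseteq> {M - t'..M} \<inter> P \<and>
             S = ({m..M} \<inter> P) - (A \<union> A'))"

end

theory Submission
  imports Defs
begin

text \<open>
  Only the rational points of $K$ matter, so unless the lattice points of the affine hull of $K$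
  already span it, $K$ may be cut down to its intersection with the affine hull of its rational
  points.  Then the direction space $V$ of $K$ is spanned by lattice vectors, and so is
  $V \cap \ker c$.  Hence every point of $V \cap \ker c$ is within a constant distance of a
  lattice point of $V \cap \ker c$.  On the other hand, pulling $n p$ with $p \in K$ by a constant
  amount towards a relative interior point produces a point of $n K$ surrounded by a ball of
  constant radius.  So every value of the right residue class, except those within a constant
  distance of the extremes of $c$ on $n K$, is attained at a lattice point.
\<close>

section \<open>Linearity of the embedding and of the functional\<close>

lemma real_vec_add: "real_vec (x + y) = real_vec x + real_vec y"
  by (simp add: real_vec_def vec_eq_iff)

lemma real_vec_diff: "real_vec (x - y) = real_vec x - real_vec y"
  by (simp add: real_vec_def vec_eq_iff)

lemma real_vec_smult: "real_vec (k *s x) = real_of_int k *\<^sub>R real_vec x"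
  by (simp add: real_vec_def vec_eq_iff)

lemma real_vec_sum: "real_vec (sum g A) = (\<Sum>a\<in>A. real_vec (g a))"
  by (simp add: real_vec_def vec_eq_iff)

lemma lin_fun_real: "real_of_int (lin_fun c x) = real_vec c \<bullet> real_vec x"
  by (simp add: lin_fun_def real_vec_def inner_vec_def)

lemma lin_fun_add: "lin_fun c (x + y) = lin_fun c x + lin_fun c y"
  by (simp add: lin_fun_def algebra_simps sum.distrib)

lemma lin_fun_diff: "lin_fun c (x - y) = lin_fun c x - lin_fun c y"
  by (simp add: lin_fun_def algebra_simps sum_subtractf)

lemma lin_fun_smult: "lin_fun c (k *s x) = k * lin_fun c x"
  by (simp add: lin_fun_def sum_distrib_left algebra_simps)

section \<open>Subspaces spanned by lattice vectors\<close>

text \<open>Rounding down the coordinates in a basis taken from \<open>S\<close> leaves a remainder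
  with coefficients in [0,1), whose norm is at most the sum of the norms of the basis
  vectors.\<close>

lemma lattice_span_covering:
  fixes S :: "(real ^ 'd) set"
  assumes "S \<subseteq> integer_lattice"
  obtains \<rho> where "\<rho> > 0"
    and "\<And>v. v \<in> span S \<Longrightarrow> \<exists>z. real_vec z \<in> span S \<and> norm (v - real_vec z) \<le> \<rho>"
proof -
  obtain B where B: "B \<subseteq> S" "independent B" "S \<subseteq> span B"
    by (rule maximal_independent_subset)
  have fin: "finite B"
    using B(2) by (rule independent_imp_finite)
  have span_eq: "span S = span B"
    using B span_mono span_minimal subspace_span by (metis subset_antisym)
  have "\<forall>b\<in>B. \<exists>z. b = real_vec z"
    using B(1) assms by blast
  then obtain g where g: "\<And>b. b \<in> B \<Longrightarrow> real_vec (g b) = b"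
    by metis
  \<comment> \<open>The summand 1 keeps \<open>\<rho>\<close> positive even when the basis is
    empty.\<close>
  define \<rho> where "\<rho> = 1 + (\<Sum>b\<in>B. norm b)"
  show ?thesis
  proof (rule that[of \<rho>])
    show "\<rho> > 0"
      unfolding \<rho>_def by (smt (verit) norm_ge_zero sum_nonneg)
    fix v assume "v \<in> span S"
    then obtain r where r: "v = (\<Sum>b\<in>B. r b *\<^sub>R b)"
      unfolding span_eq span_finite[OF fin] by auto
    define z where "z = (\<Sum>b\<in>B. \<lfloor>r b\<rfloor> *s g b)"
    have z: "real_vec z = (\<Sum>b\<in>B. real_of_int \<lfloor>r b\<rfloor> *\<^sub>R b)"
      by (simp add: z_def real_vec_sum real_vec_smult g)
    have "v - real_vec z = (\<Sum>b\<in>B. frac (r b) *\<^sub>R b)"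
      by (simp add: r z frac_def algebra_simps sum_subtractf)
    also have "norm \<dots> \<le> (\<Sum>b\<in>B. norm b)"
      by (rule sum_norm_le) (simp add: mult_left_le_one_le less_imp_le[OF frac_lt_1])
    finally have "norm (v - real_vec z) \<le> \<rho>"
      by (simp add: \<rho>_def)
    moreover have "real_vec z \<in> span S"
      unfolding span_eq z by (intro span_sum span_scale span_base)
    ultimately show "\<exists>z. real_vec z \<in> span S \<and> norm (v - real_vec z) \<le> \<rho>"
      by blast
  qed
qed

text \<open>Let s be the value of c at \<open>e\<close>. The map sending x to s x - (c . x) e
  carries \<open>V\<close> into \<open>U\<close>, takes lattice vectors to lattice vectors because
  its coefficients are then integers, and is multiplication by s on \<open>U\<close>. So
  \<open>U\<close> inherits a spanning set of lattice vectors from \<open>V\<close>.\<close>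

lemma rational_hyperplane_section:
  fixes V :: "(real ^ 'd) set"
  assumes V: "span (V \<inter> integer_lattice) = V"
    and e: "real_vec e \<in> V" "lin_fun c e > 0"
  defines "U \<equiv> {v \<in> V. real_vec c \<bullet> v = 0}"
  shows "span (U \<inter> integer_lattice) = U"
proof
  have subV: "subspace V"
    using V by (metis subspace_span)
  have subU: "subspace U"
    unfolding U_def using subV by (auto simp: subspace_def inner_add_right)
  show "span (U \<inter> integer_lattice) \<subseteq> U"
    by (rule span_minimal[OF _ subU]) blast
  define s where "s = lin_fun c e"
  define g where "g x = real_of_int s *\<^sub>R x - (real_vec c \<bullet> x) *\<^sub>R real_vec e" for x :: "real ^ 'd"
  have lin: "linear g"
    by (rule linearI) (auto simp: g_def algebra_simps inner_add_right)
  have "g ` (V \<inter> integer_lattice) \<subseteq> U \<inter> integer_lattice"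
  proof (rule image_subsetI)
    fix x assume "x \<in> V \<inter> integer_lattice"
    then obtain z where z: "x = real_vec z" "real_vec z \<in> V" by auto
    have gx: "g x = real_vec (s *s z - lin_fun c z *s e)"
      by (simp add: g_def z real_vec_diff real_vec_smult lin_fun_real)
    have "g x \<in> V"
      unfolding g_def z(1) by (intro subspace_diff subspace_scale subV z e)
    moreover have "real_vec c \<bullet> g x = 0"
      by (simp add: g_def inner_diff_right s_def lin_fun_real)
    ultimately show "g x \<in> U \<inter> integer_lattice"
      using gx by (auto simp: U_def)
  qed
  then have "span (g ` (V \<inter> integer_lattice)) \<subseteq> span (U \<inter> integer_lattice)"
    by (rule span_mono)
  then have gV: "g ` V \<subseteq> span (U \<inter> integer_lattice)"
    by (simp add: span_linear_image[OF lin] V)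
  show "U \<subseteq> span (U \<inter> integer_lattice)"
  proof
    fix v assume "v \<in> U"
    then have "v \<in> V" "g v = real_of_int s *\<^sub>R v"
      by (auto simp: U_def g_def)
    then have "real_of_int s *\<^sub>R v \<in> span (U \<inter> integer_lattice)"
      using gV by force
    then have "inverse (real_of_int s) *\<^sub>R real_of_int s *\<^sub>R v \<in> span (U \<inter> integer_lattice)"
      by (rule span_scale)
    then show "v \<in> span (U \<inter> integer_lattice)"
      using e(2) by (simp add: s_def)
  qed
qed

section \<open>Subgroups of the integers and a criterion for almost progressions\<close>

text \<open>The least positive element works: remainders modulo it stay in \<open>H\<close>, so they
  vanish. For the values of c on the lattice vectors of a subspace, this generator becomes the step
  size.\<close>

lemma int_subgroup_generator:
  fixes H :: "int set"
  assumes "h \<in> H" "h \<noteq> 0"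
    and diff: "\<And>x y. x \<in> H \<Longrightarrow> y \<in> H \<Longrightarrow> x - y \<in> H"
    and mult: "\<And>k x. x \<in> H \<Longrightarrow> k * x \<in> H"
  obtains s where "s > 0" "s \<in> H" "\<And>x. x \<in> H \<Longrightarrow> s dvd x"
proof -
  have "\<bar>h\<bar> \<in> H"
    using mult[OF assms(1), of "sgn h"] by (simp add: abs_sgn mult.commute)
  then have ex: "\<exists>n::nat. n > 0 \<and> int n \<in> H"
    using assms(2) by (intro exI[of _ "nat \<bar>h\<bar>"]) auto
  define m where "m = (LEAST n::nat. n > 0 \<and> int n \<in> H)"
  have m: "m > 0" "int m \<in> H"
    using LeastI_ex[OF ex] by (auto simp: m_def)
  show ?thesis
  proof (rule that[of "int m"])
    fix x assume "x \<in> H"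
    then have "x mod int m \<in> H"
      unfolding minus_div_mult_eq_mod[symmetric] by (intro diff mult m(2))
    moreover have "0 \<le> x mod int m" "x mod int m < int m"
      using m(1) by auto
    ultimately have "x mod int m = 0"
      using not_less_Least[of "nat (x mod int m)" "\<lambda>n. n > 0 \<and> int n \<in> H"]
      by (fastforce simp flip: m_def)
    then show "int m dvd x"
      by auto
  qed (use m in auto)
qed

text \<open>The bounds \<open>lo\<close> and \<open>hi\<close> need not be attained, and
  \<open>r\<close> only names the residue class. Since the minimum is at least \<open>lo\<close> and
  the maximum at most \<open>hi\<close>, any integer of the class lying more than \<open>T\<close>
  inside both of them is covered by \<open>full\<close>.\<close>

lemma almost_arith_progI:
  fixes lo hi T :: real
  assumes "s > 0" "S \<noteq> {}"
    and bnd: "\<And>y. y \<in> S \<Longrightarrow> lo \<le> real_of_int y \<and> real_of_int y \<le> hi"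
    and coset: "\<And>y. y \<in> S \<Longrightarrow> s dvd y - r"
    and full: "\<And>y. s dvd y - r \<Longrightarrow> lo + T \<le> real_of_int y \<Longrightarrow> real_of_int y \<le> hi - T \<Longrightarrow> y \<in> S"
  shows "almost_arith_prog s \<lceil>T\<rceil> \<lceil>T\<rceil> S"
proof -
  have fin: "finite S"
  proof (rule finite_subset)
    show "S \<subseteq> {\<lfloor>lo\<rfloor>..\<lceil>hi\<rceil>}"
      using bnd by (force simp: floor_le_iff le_ceiling_iff)
  qed simp
  define m M P where "m = Min S" and "M = Max S" and "P = range (\<lambda>k. m + s * k)"
  have m: "m \<in> S" "\<And>y. y \<in> S \<Longrightarrow> m \<le> y" and M: "M \<in> S" "\<And>y. y \<in> S \<Longrightarrow> y \<le> M"
    using fin assms(2) by (auto simp: m_def M_def)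
  have P: "y \<in> P \<longleftrightarrow> s dvd y - r" for y
  proof -
    have "y \<in> P \<longleftrightarrow> s dvd y - m"
      unfolding P_def dvd_def by (auto simp: algebra_simps)
    \<comment> \<open>The minimum itself lies in the class of \<open>r\<close>, so both represent
      the same coset.\<close>
    also have "\<dots> \<longleftrightarrow> s dvd y - r"
      using coset[OF m(1)] by (metis diff_diff_eq2 dvd_diff dvd_add diff_add_cancel add_diff_eq)
    finally show ?thesis .
  qed
  \<comment> \<open>The largest admissible exceptional sets: every gap near either end.\<close>
  define A A' where "A = {m..m + \<lceil>T\<rceil>} \<inter> P - S" and "A' = {M - \<lceil>T\<rceil>..M} \<inter> P - S"
  have "S = ({m..M} \<inter> P) - (A \<union> A')"
  proof (intro equalityI subsetI)
    fix y assume "y \<in> S"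
    then show "y \<in> ({m..M} \<inter> P) - (A \<union> A')"
      using m M P coset by (auto simp: A_def A'_def)
  next
    fix y assume y: "y \<in> ({m..M} \<inter> P) - (A \<union> A')"
    show "y \<in> S"
    proof (rule ccontr)
      assume "y \<notin> S"
      then have "m + \<lceil>T\<rceil> < y" "y < M - \<lceil>T\<rceil>" "s dvd y - r"
        using y P by (auto simp: A_def A'_def)
      moreover from this have "lo + T \<le> y" "y \<le> hi - T"
        using bnd[OF m(1)] bnd[OF M(1)] le_of_int_ceiling[of T] by linarith+
      ultimately show False
        using full \<open>y \<notin> S\<close> by blast
    qed
  qed
  moreover have "A \<subseteq> {m..m + \<lceil>T\<rceil>} \<inter> P" "A' \<subseteq> {M - \<lceil>T\<rceil>..M} \<inter> P"
    by (auto simp: A_def A'_def)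
  ultimately have "\<exists>A A'. A \<subseteq> {m..m + \<lceil>T\<rceil>} \<inter> P \<and> A' \<subseteq> {M - \<lceil>T\<rceil>..M} \<inter> P \<and>
      S = ({m..M} \<inter> P) - (A \<union> A')"
    by blast
  then show ?thesis
    using fin assms(1,2) by (simp add: almost_arith_prog_def Let_def m_def M_def P_def)
qed

section \<open>Lattice points in dilates\<close>

text \<open>By convexity, the point (n - \<tau>) p + \<tau> q is the centre of a ball of radius
  \<tau> \<epsilon>, in the directions of \<open>V\<close>, inside \<open>n K\<close>. This radius
  is large enough for a lattice vector of \<open>U\<close> to move \<open>x\<close> into the ball.
  Taking \<open>U = V\<close> yields some lattice point; taking the kernel of c in \<open>V\<close>
  yields one with a prescribed value of c.\<close>

lemma lattice_point_in_dilate: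
  fixes K V U :: "(real ^ 'd) set"
  assumes "convex K" "\<epsilon> > 0"
    and ball: "\<And>v. v \<in> V \<Longrightarrow> norm v \<le> \<epsilon> \<Longrightarrow> q + v \<in> K"
    and V: "subspace V" and U: "subspace U" "U \<subseteq> V"
    and cover: "\<And>v. v \<in> U \<Longrightarrow> \<exists>z. real_vec z \<in> U \<and> norm (v - real_vec z) \<le> \<tau> * \<epsilon>"
    and \<tau>: "0 < \<tau>" "\<tau> \<le> n" and "p \<in> K"
    and x: "real_vec x - ((n - \<tau>) *\<^sub>R p + \<tau> *\<^sub>R q) \<in> U"
  shows "\<exists>z. real_vec z \<in> (*\<^sub>R) n ` K \<and> real_vec (z - x) \<in> U"
proof -
  define u where "u = (n - \<tau>) *\<^sub>R p + \<tau> *\<^sub>R q"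
  have "u - real_vec x \<in> U"
    using subspace_neg[OF U(1) x] by (simp add: u_def)
  then obtain w where w: "real_vec w \<in> U" "norm (u - real_vec x - real_vec w) \<le> \<tau> * \<epsilon>"
    using cover by blast
  define v where "v = real_vec w - (u - real_vec x)"
  have "v \<in> V"
    using subspace_diff[OF U(1) w(1) \<open>u - real_vec x \<in> U\<close>] U(2) by (auto simp: v_def)
  have "norm v \<le> \<tau> * \<epsilon>"
    using w(2) by (simp add: v_def norm_minus_commute)
  then have q: "q + inverse \<tau> *\<^sub>R v \<in> K"
    using \<tau>(1) by (intro ball subspace_scale V \<open>v \<in> V\<close>) (simp add: divide_simps mult.commute)
  have n: "n > 0" using \<tau> by simp
  \<comment> \<open>The target point scaled by 1/n: the whole offset \<open>v\<close> is absorbed by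
    \<open>q\<close>, whose weight is \<tau>/n.\<close>
  have "((n - \<tau>) / n) *\<^sub>R p + (\<tau> / n) *\<^sub>R (q + inverse \<tau> *\<^sub>R v) \<in> K"
    using \<tau> n by (intro convexD[OF \<open>convex K\<close> \<open>p \<in> K\<close> q]) (auto simp: divide_simps)
  moreover have "real_vec (x + w) = n *\<^sub>R (((n - \<tau>) / n) *\<^sub>R p + (\<tau> / n) *\<^sub>R (q + inverse \<tau> *\<^sub>R v))"
    using \<tau> n by (simp add: scaleR_add_right v_def u_def real_vec_add)
  ultimately have "real_vec (x + w) \<in> (*\<^sub>R) n ` K"
    by blast
  then show ?thesis
    using w(1) by (intro exI[of _ "x + w"]) simp
qed

section \<open>Bodies whose direction space is spanned by lattice vectors\<close>

text \<open>Since \<open>n K\<close> lies in n q + V, it can meet the lattice only if this translate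
  does; hence the premise on \<open>n\<close>. The lattice points of the translate form one coset of
  the lattice of \<open>V\<close>, so the residue class may vary with \<open>n\<close> while the
  step size and the bounds stay fixed.\<close>

lemma arith_range_almost_arith_prog:
  fixes K :: "(real ^ 'd) set" and c :: "int ^ 'd"
  assumes "compact K" "convex K" "q \<in> K" "\<epsilon> > 0"
    and ball: "\<And>v. v \<in> V \<Longrightarrow> norm v \<le> \<epsilon> \<Longrightarrow> q + v \<in> K"
    and dir: "\<And>x. x \<in> K \<Longrightarrow> x - q \<in> V"
    and V: "span (V \<inter> integer_lattice) = V"
  shows "\<exists>s t t'. \<forall>\<^sub>F n in sequentially. (\<exists>x. real_vec x - real n *\<^sub>R q \<in> V) \<longrightarrow>
           almost_arith_prog s t t' (arith_range c ((*\<^sub>R) (real n) ` K))"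
proof -
  define f where "f x = real_vec c \<bullet> x" for x
  define S where "S n = arith_range c ((*\<^sub>R) (real n) ` K)" for n
  have subV: "subspace V"
    using V by (metis subspace_span)
  have "continuous_on K f"
    unfolding f_def by (intro continuous_intros)
  then obtain p p' where p: "p \<in> K" "\<And>x. x \<in> K \<Longrightarrow> f p \<le> f x"
    and p': "p' \<in> K" "\<And>x. x \<in> K \<Longrightarrow> f x \<le> f p'"
    using continuous_attains_inf continuous_attains_sup assms(1,3) by (metis empty_iff)
  have bnd: "real n * f p \<le> y" "y \<le> real n * f p'" if "y \<in> S n" for n y
    using that p p' unfolding S_def arith_range_def
    by (auto simp: lin_fun_real f_def intro!: mult_left_mono)
  obtain \<rho>1 where \<rho>1: "\<rho>1 > 0"
    "\<And>v. v \<in> V \<Longrightarrow> \<exists>z. real_vec z \<in> V \<and> norm (v - real_vec z) \<le> \<rho>1"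
    using lattice_span_covering[of "V \<inter> integer_lattice"] unfolding V by blast
  have nonempty: "S n \<noteq> {}" if n: "real n \<ge> \<rho>1 / \<epsilon>" and x: "real_vec x - real n *\<^sub>R q \<in> V" for n x
  proof -
    \<comment> \<open>Here \<open>U = V\<close> and \<open>p = q\<close>; the factor
      \<open>\<rho>1 / \<epsilon>\<close> enlarges the ball to the covering radius.\<close>
    have "\<exists>z. real_vec z \<in> (*\<^sub>R) (real n) ` K \<and> real_vec (z - x) \<in> V"
      by (rule lattice_point_in_dilate[of K \<epsilon> V q V "\<rho>1 / \<epsilon>" "real n" q])
        (use assms ball subV \<rho>1 n x in \<open>auto simp: algebra_simps\<close>)
    then show ?thesis
      by (auto simp: S_def arith_range_def)
  qed
  have large: "\<forall>\<^sub>F n in sequentially. C \<le> real n" for C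
    using filterlim_real_sequentially by (auto simp: filterlim_at_top)
  show ?thesis
  proof (cases "f p = f p'")
    case True
    \<comment> \<open>When c is constant on \<open>K\<close>, the range is a single value.\<close>
    have "almost_arith_prog 1 0 0 (S n)"
      if n: "real n \<ge> \<rho>1 / \<epsilon>" and x: "real_vec x - real n *\<^sub>R q \<in> V" for n x
    proof -
      have ne: "S n \<noteq> {}"
        using nonempty n x by blast
      have eq: "real_of_int y = real n * f p" if "y \<in> S n" for y
        using bnd[OF that] True by simp
      have "almost_arith_prog 1 \<lceil>0::real\<rceil> \<lceil>0::real\<rceil> (S n)"
      proof (rule almost_arith_progI[of _ _ "real n * f p" "real n * f p" 0])
        fix y :: int
        assume "real n * f p + 0 \<le> y" "y \<le> real n * f p - 0"
        then have "real_of_int y = real n * f p" by simp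
        then show "y \<in> S n"
          using ne eq by (metis ex_in_conv of_int_eq_iff)
      qed (use ne eq in auto)
      then show ?thesis by simp
    qed
    then show ?thesis
      unfolding S_def
      by (intro exI[of _ 1] exI[of _ 0]) (auto intro: eventually_mono[OF large[of "\<rho>1 / \<epsilon>"]])
  next
    case False
    then have lt: "f p < f p'"
      using p(2)[OF p'(1)] by simp
    \<comment> \<open>Otherwise c would vanish on all of \<open>V\<close>, which contains
      \<open>p - q\<close> and \<open>p' - q\<close>, although its values at \<open>p\<close> and
      \<open>p'\<close> differ.\<close>
    have "\<exists>z. real_vec z \<in> V \<and> lin_fun c z \<noteq> 0"
    proof (rule ccontr)
      assume "\<not> ?thesis"
      then have "V \<inter> integer_lattice \<subseteq> {v. f v = 0}"
        by (auto simp: f_def simp flip: lin_fun_real)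
      moreover have "subspace {v. f v = 0}"
        by (auto simp: f_def subspace_def inner_add_right)
      ultimately have "span (V \<inter> integer_lattice) \<subseteq> {v. f v = 0}"
        by (rule span_minimal)
      then have "f (p' - q) = 0" "f (p - q) = 0"
        using dir p p' unfolding V by blast+
      then show False
        using lt by (simp add: f_def inner_diff_right)
    qed
    then obtain z0 where z0: "real_vec z0 \<in> V" "lin_fun c z0 \<noteq> 0" by blast
    define H where "H = {lin_fun c z | z. real_vec z \<in> V}"
    obtain s where s: "s > 0" "s \<in> H" "\<And>x. x \<in> H \<Longrightarrow> s dvd x"
    proof (rule int_subgroup_generator[of "lin_fun c z0" H])
      show "x - y \<in> H" if "x \<in> H" "y \<in> H" for x y
        using that subspace_diff[OF subV] unfolding H_def
        by (auto simp flip: lin_fun_diff) (metis real_vec_diff)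
      show "k * x \<in> H" if "x \<in> H" for k x
        using that subspace_scale[OF subV] unfolding H_def
        by (auto simp flip: lin_fun_smult) (metis real_vec_smult)
    qed (use z0 in \<open>auto simp: H_def\<close>)
    then obtain e where e: "real_vec e \<in> V" "lin_fun c e = s"
      by (auto simp: H_def)
    define U where "U = {v \<in> V. real_vec c \<bullet> v = 0}"
    have spanU: "span (U \<inter> integer_lattice) = U"
      unfolding U_def by (rule rational_hyperplane_section[OF V e(1)]) (use e s in simp)
    then have subU: "subspace U"
      by (metis subspace_span)
    obtain \<rho> where \<rho>: "\<rho> > 0"
      "\<And>v. v \<in> U \<Longrightarrow> \<exists>z. real_vec z \<in> U \<and> norm (v - real_vec z) \<le> \<rho>"
      using lattice_span_covering[of "U \<inter> integer_lattice"] unfolding spanU by blast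
    \<comment> \<open>The scale at which the ball around \<open>q\<close> reaches the covering
      radius of \<open>U\<close>.\<close>
    define \<tau> where "\<tau> = \<rho> / \<epsilon>"
    have \<tau>: "\<tau> > 0" "\<rho> = \<tau> * \<epsilon>"
      using \<rho> assms(4) by (auto simp: \<tau>_def)
    \<comment> \<open>Shifting weight \<open>\<tau>\<close> from an extremal point to
      \<open>q\<close> changes the value of c by at most \<open>\<tau>\<close> times the width of
      \<open>K\<close>.\<close>
    define T where "T = \<tau> * (f p' - f p)"
    have "almost_arith_prog s \<lceil>T\<rceil> \<lceil>T\<rceil> (S n)"
      if n: "real n \<ge> \<rho>1 / \<epsilon>" "real n \<ge> \<tau> + 1" and x: "real_vec x - real n *\<^sub>R q \<in> V" for n x
    proof (rule almost_arith_progI[of _ _ "real n * f p" "real n * f p'" "lin_fun c x"])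
      show "S n \<noteq> {}"
        using nonempty n x by blast
      show "real n * f p \<le> y \<and> y \<le> real n * f p'" if "y \<in> S n" for y
        using bnd that by blast
      show "s dvd y - lin_fun c x" if y: "y \<in> S n" for y
      proof -
        obtain z k where z: "y = lin_fun c z" "real_vec z = real n *\<^sub>R k" "k \<in> K"
          using y by (auto simp: S_def arith_range_def)
        have "real_vec (z - x) = real n *\<^sub>R (k - q) - (real_vec x - real n *\<^sub>R q)"
          by (simp add: real_vec_diff z algebra_simps)
        also have "\<dots> \<in> V"
          by (intro subspace_diff subspace_scale subV dir z x)
        finally show ?thesis
          unfolding z(1) lin_fun_diff[symmetric] by (intro s(3)) (auto simp: H_def)
      qed
      fix y assume y: "s dvd y - lin_fun c x" "real n * f p + T \<le> y" "y \<le> real n * f p' - T"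
      have nt: "real n - \<tau> > 0" using n(2) by simp
      \<comment> \<open>The value required of \<open>p0\<close> for (n - \<tau>) p0 + \<tau> q to
        have value \<open>y\<close>. The margin \<open>T\<close> at both ends keeps it between the
        extremes of c on \<open>K\<close>.\<close>
      define h where "h = (real_of_int y - \<tau> * f q) / (real n - \<tau>)"
      have "\<tau> * f p \<le> \<tau> * f q" "\<tau> * f q \<le> \<tau> * f p'"
        using p(2)[OF assms(3)] p'(2)[OF assms(3)] \<tau>(1) by auto
      then have "f p * (real n - \<tau>) \<le> real_of_int y - \<tau> * f q"
        "real_of_int y - \<tau> * f q \<le> f p' * (real n - \<tau>)"
        using y(2,3) by (simp_all add: T_def algebra_simps)
      then have "f p \<le> h" "h \<le> f p'"
        unfolding h_def using nt by (simp_all add: pos_le_divide_eq pos_divide_le_eq)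
      then obtain p0 where p0: "p0 \<in> K" "f p0 = h"
        using connected_ivt_hyperplane[OF convex_connected[OF assms(2)] p(1) p'(1)]
        by (auto simp: f_def)
      obtain k where k: "y - lin_fun c x = s * k"
        using y(1) by (auto simp: dvd_def)
      \<comment> \<open>Multiples of \<open>e\<close> change the value by multiples of
        \<open>s\<close> without leaving n q + V, so the value \<open>y\<close> is reached.\<close>
      define x' where "x' = x + k *s e"
      have x': "lin_fun c x' = y"
        using k by (simp add: x'_def lin_fun_add lin_fun_smult e algebra_simps)
      define u where "u = (real n - \<tau>) *\<^sub>R p0 + \<tau> *\<^sub>R q"
      have "f u = (real n - \<tau>) * h + \<tau> * f q"
        using p0(2) by (simp add: u_def f_def inner_add_right)
      also have "\<dots> = y"
        using nt by (simp add: h_def)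
      finally have "f (real_vec x' - u) = 0"
        by (simp add: f_def inner_diff_right flip: lin_fun_real x')
      moreover have "real_vec x' - u \<in> V"
      proof -
        have "real_vec x' - u = (real_vec x - real n *\<^sub>R q) + real_of_int k *\<^sub>R real_vec e
            - (real n - \<tau>) *\<^sub>R (p0 - q)"
          by (simp add: x'_def u_def real_vec_add real_vec_smult algebra_simps)
        also have "\<dots> \<in> V"
          by (intro subspace_diff subspace_add subspace_scale subV dir x e p0)
        finally show ?thesis .
      qed
      \<comment> \<open>Now only a correction by a lattice vector of \<open>U\<close> remains, and
        it preserves the value \<open>y\<close>.\<close>
      ultimately have "real_vec x' - u \<in> U"
        by (simp add: U_def f_def)
      then have "\<exists>z. real_vec z \<in> (*\<^sub>R) (real n) ` K \<and> real_vec (z - x') \<in> U"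
        unfolding u_def
        by (intro lattice_point_in_dilate[of K \<epsilon> V q U \<tau> "real n" p0])
          (use assms ball subV subU \<rho> \<tau> n p0 in \<open>auto simp: U_def\<close>)
      then obtain z where z: "real_vec z \<in> (*\<^sub>R) (real n) ` K" "real_vec (z - x') \<in> U"
        by blast
      have "real_of_int (lin_fun c (z - x')) = 0"
        using z(2) by (simp add: U_def lin_fun_real)
      then have "lin_fun c z = y"
        using x' by (simp add: lin_fun_diff)
      then show "y \<in> S n"
        using z(1) by (auto simp: S_def arith_range_def)
    qed (rule s(1))
    then have "\<forall>\<^sub>F n in sequentially. (\<exists>x. real_vec x - real n *\<^sub>R q \<in> V) \<longrightarrow>
           almost_arith_prog s \<lceil>T\<rceil> \<lceil>T\<rceil> (S n)"
      using eventually_conj[OF large[of "\<rho>1 / \<epsilon>"] large[of "\<tau> + 1"]]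
      by (auto elim!: eventually_mono)
    then show ?thesis
      unfolding S_def by blast
  qed
qed

section \<open>Affine hulls spanned by rational points\<close>

text \<open>Clearing denominators turns differences of points of \<open>R\<close> into lattice
  vectors, and these span the direction space of \<open>K\<close>. Only the hulls have to agree, so
  \<open>R\<close> may contain points outside \<open>K\<close>.\<close>

lemma arith_range_almost_arith_prog_rational:
  fixes K :: "(real ^ 'd) set" and c :: "int ^ 'd"
  assumes K: "compact K" "convex K" "K \<noteq> {}"
    and R: "affine hull R = affine hull K"
    and rat: "\<And>x. x \<in> R \<Longrightarrow> \<exists>m>0. real m *\<^sub>R x \<in> integer_lattice"
  shows "\<exists>s t t'. \<forall>\<^sub>F n in sequentially.
           (\<exists>x. real_vec x \<in> (*\<^sub>R) (real n) ` (affine hull K)) \<longrightarrow>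
           almost_arith_prog s t t' (arith_range c ((*\<^sub>R) (real n) ` K))"
proof -
  obtain q where "q \<in> rel_interior K"
    using rel_interior_eq_empty[OF K(2)] K(3) by blast
  then obtain \<epsilon> where q: "q \<in> K" and \<epsilon>: "\<epsilon> > 0" "cball q \<epsilon> \<inter> affine hull K \<subseteq> K"
    by (auto simp: mem_rel_interior_cball)
  define V where "V = (\<lambda>x. x - q) ` (affine hull K)"
  have qaff: "q \<in> affine hull K"
    using q by (rule hull_inc)
  have subV: "subspace V"
    by (simp add: V_def diffs_affine_hull_span[OF q])
  obtain r0 where r0: "r0 \<in> R"
    using R K(3) by (metis affine_hull_eq_empty ex_in_conv)
  have r0V: "r0 - q \<in> V"
    using r0 R by (auto simp: V_def intro: hull_inc)
  \<comment> \<open>The base point moves from \<open>q\<close>, which may be irrational, to the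
    rational point \<open>r0\<close>.\<close>
  have "V \<subseteq> (\<lambda>x. x - r0) ` (affine hull R)"
  proof
    fix v assume "v \<in> V"
    then have "v + (r0 - q) \<in> V"
      by (rule subspace_add[OF subV _ r0V])
    then obtain a where "a \<in> affine hull K" "v + (r0 - q) = a - q"
      by (auto simp: V_def)
    then have "v + r0 \<in> affine hull K"
      by (simp add: algebra_simps)
    then show "v \<in> (\<lambda>x. x - r0) ` (affine hull R)"
      by (intro image_eqI[of _ _ "v + r0"]) (auto simp: R)
  qed
  also have "\<dots> = span ((\<lambda>x. x - r0) ` R)"
    by (rule diffs_affine_hull_span[OF r0])
  also have "\<dots> \<subseteq> span (V \<inter> integer_lattice)"
  proof (rule span_minimal[OF _ subspace_span], safe)
    fix r assume r: "r \<in> R"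
    obtain m m0 where m: "m > 0" "real m *\<^sub>R r \<in> integer_lattice"
      and m0: "m0 > 0" "real m0 *\<^sub>R r0 \<in> integer_lattice"
      using rat[OF r] rat[OF r0] by blast
    obtain z z0 where z: "real_vec z = real m *\<^sub>R r" "real_vec z0 = real m0 *\<^sub>R r0"
      using m(2) m0(2) by (metis imageE)
    have "r - q \<in> V"
      using r R by (auto simp: V_def intro: hull_inc)
    then have "r - r0 \<in> V"
      using subspace_diff[OF subV _ r0V] by force
    \<comment> \<open>The product of both denominators makes the difference a lattice
      vector.\<close>
    then have "(real m * real m0) *\<^sub>R (r - r0) \<in> V"
      by (rule subspace_scale[OF subV])
    moreover have "(real m * real m0) *\<^sub>R (r - r0) = real_vec (int m0 *s z - int m *s z0)"
      by (simp add: real_vec_diff real_vec_smult z algebra_simps)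
    ultimately have "(real m * real m0) *\<^sub>R (r - r0) \<in> span (V \<inter> integer_lattice)"
      by (intro span_base) auto
    then have "inverse (real m * real m0) *\<^sub>R (real m * real m0) *\<^sub>R (r - r0)
        \<in> span (V \<inter> integer_lattice)"
      by (rule span_scale)
    then show "r - r0 \<in> span (V \<inter> integer_lattice)"
      using m(1) m0(1) by (metis left_inverse mult_eq_0_iff of_nat_eq_0_iff less_irrefl scaleR_one scaleR_scaleR)
  qed
  finally have V: "span (V \<inter> integer_lattice) = V"
    using span_minimal[OF _ subV, of "V \<inter> integer_lattice"] by blast
  have "\<exists>s t t'. \<forall>\<^sub>F n in sequentially. (\<exists>x. real_vec x - real n *\<^sub>R q \<in> V) \<longrightarrow>
      almost_arith_prog s t t' (arith_range c ((*\<^sub>R) (real n) ` K))"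
  proof (rule arith_range_almost_arith_prog[OF K(1,2) q \<epsilon>(1) _ _ V])
    fix v assume v: "v \<in> V" "norm v \<le> \<epsilon>"
    then have "q + v \<in> cball q \<epsilon> \<inter> affine hull K"
      by (auto simp: V_def dist_norm norm_minus_commute)
    then show "q + v \<in> K"
      using \<epsilon>(2) by blast
  next
    fix x assume "x \<in> K"
    then show "x - q \<in> V"
      by (auto simp: V_def intro: hull_inc)
  qed
  then obtain s t t' where ev: "\<forall>\<^sub>F n in sequentially.
      (\<exists>x. real_vec x - real n *\<^sub>R q \<in> V) \<longrightarrow>
      almost_arith_prog s t t' (arith_range c ((*\<^sub>R) (real n) ` K))"
    by blast
  have "real_vec x - real n *\<^sub>R q \<in> V"
    if x: "real_vec x \<in> (*\<^sub>R) (real n) ` (affine hull K)" for x n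
  proof -
    obtain k where k: "real_vec x = real n *\<^sub>R k" "k \<in> affine hull K"
      using x by blast
    then have "real n *\<^sub>R (k - q) \<in> V"
      by (intro subspace_scale[OF subV]) (auto simp: V_def)
    then show ?thesis
      by (simp add: k algebra_simps)
  qed
  then have "\<forall>\<^sub>F n in sequentially. (\<exists>x. real_vec x \<in> (*\<^sub>R) (real n) ` (affine hull K)) \<longrightarrow>
      almost_arith_prog s t t' (arith_range c ((*\<^sub>R) (real n) ` K))"
    by (intro eventually_mono[OF ev]) blast
  then show ?thesis
    by blast
qed

section \<open>Reduction to the rational points of the body\<close>

text \<open>Almost progressions are nonempty, but a dilate may miss the lattice: take a segment
  avoiding 0 on a line whose only lattice point is 0. So if the lattice points do not span the hull,
  the claim concerns only those \<open>n\<close> with a nonempty range.\<close>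

theorem theorem3p3:
  fixes K :: "(real ^ 'd) set" and c :: "int ^ 'd"
  assumes "compact K" and "convex K"
    and "affine hull K \<inter> integer_lattice \<noteq> {}"
  shows "\<exists>s t t'. \<forall>\<^sub>F n in sequentially.
           arith_range c ((*\<^sub>R) (real n) ` K) \<noteq> {} \<or>
           affine hull (affine hull K \<inter> integer_lattice) = affine hull K \<longrightarrow>
           almost_arith_prog s t t' (arith_range c ((*\<^sub>R) (real n) ` K))"
proof (cases "affine hull (affine hull K \<inter> integer_lattice) = affine hull K")
  case True
  obtain x0 where x0: "real_vec x0 \<in> affine hull K"
    using assms(3) by blast
  \<comment> \<open>The multiples of \<open>x0\<close> meet the premise on \<open>n\<close> for
    every \<open>n\<close>.\<close>
  have "\<exists>x. real_vec x \<in> (*\<^sub>R) (real n) ` (affine hull K)" for n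
    using x0 by (intro exI[of _ "int n *s x0"]) (auto simp: real_vec_smult)
  moreover have "\<exists>m>0. real m *\<^sub>R x \<in> integer_lattice"
    if "x \<in> affine hull K \<inter> integer_lattice" for x
    using that by (intro exI[of _ 1]) auto
  moreover have "K \<noteq> {}"
    using assms(3) by auto
  ultimately obtain s t t' where "\<forall>\<^sub>F n in sequentially.
      almost_arith_prog s t t' (arith_range c ((*\<^sub>R) (real n) ` K))"
    using arith_range_almost_arith_prog_rational[OF assms(1,2) _ True, of c] by auto
  then have "\<forall>\<^sub>F n in sequentially.
      arith_range c ((*\<^sub>R) (real n) ` K) \<noteq> {} \<or>
      affine hull (affine hull K \<inter> integer_lattice) = affine hull K \<longrightarrow>
      almost_arith_prog s t t' (arith_range c ((*\<^sub>R) (real n) ` K))"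
    by (rule eventually_mono) blast
  then show ?thesis
    by blast
next
  case False
  \<comment> \<open>The rational points of \<open>K\<close>. For positive \<open>n\<close>, a
    lattice point of \<open>n K\<close> is n times a point of \<open>R\<close>, so cutting
    \<open>K\<close> down to the hull of \<open>R\<close> loses none of them.\<close>
  define R where "R = {x \<in> K. \<exists>m>0. real m *\<^sub>R x \<in> integer_lattice}"
  define K' where "K' = K \<inter> affine hull R"
  have range_eq: "arith_range c ((*\<^sub>R) (real n) ` K') = arith_range c ((*\<^sub>R) (real n) ` K)"
    if "n > 0" for n
  proof -
    have "k \<in> K'" if "k \<in> K" "real_vec x = real n *\<^sub>R k" for k x
      using that \<open>n > 0\<close> unfolding K'_def R_def by (auto intro!: hull_inc) (metis rangeI)
    then show ?thesis
      unfolding arith_range_def by (auto simp: K'_def image_iff)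
  qed
  show ?thesis
  proof (cases "K' = {}")
    case True
    \<comment> \<open>All positive dilates have an empty range, so both alternatives of the premise
      fail.\<close>
    then show ?thesis
      using range_eq False
      by (intro exI) (auto simp: arith_range_def intro!: eventually_mono[OF eventually_gt_at_top[of 0]])
  next
    case ne: False
    \<comment> \<open>The rational points survive the cut, so they span the hull of
      \<open>K'\<close>.\<close>
    have "R \<subseteq> K'"
      by (auto simp: K'_def R_def intro: hull_inc)
    then have hull: "affine hull R = affine hull K'"
      by (intro equalityI hull_mono hull_minimal) (auto simp: K'_def)
    have "compact K'" "convex K'"
      unfolding K'_def using assms(1,2)
      by (auto intro!: compact_Int_closed convex_Int affine_imp_convex[OF affine_affine_hull])
    from arith_range_almost_arith_prog_rational[OF this ne hull, of c]
    obtain s t t' where ev: "\<forall>\<^sub>F n in sequentially.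
        (\<exists>x. real_vec x \<in> (*\<^sub>R) (real n) ` (affine hull K')) \<longrightarrow>
        almost_arith_prog s t t' (arith_range c ((*\<^sub>R) (real n) ` K'))"
      by (auto simp: R_def)
    have "\<forall>\<^sub>F n in sequentially. arith_range c ((*\<^sub>R) (real n) ` K) \<noteq> {} \<longrightarrow>
        almost_arith_prog s t t' (arith_range c ((*\<^sub>R) (real n) ` K))"
      using ev eventually_gt_at_top[of 0]
    proof eventually_elim
      case (elim n)
      show ?case
      proof
        assume "arith_range c ((*\<^sub>R) (real n) ` K) \<noteq> {}"
        then obtain x where "real_vec x \<in> (*\<^sub>R) (real n) ` K'"
          unfolding range_eq[OF elim(2), symmetric] by (auto simp: arith_range_def)
        then have "real_vec x \<in> (*\<^sub>R) (real n) ` (affine hull K')"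
          using hull_subset[of K' affine] by blast
        then show "almost_arith_prog s t t' (arith_range c ((*\<^sub>R) (real n) ` K))"
          using elim range_eq by auto
      qed
    qed
    then show ?thesis
      using False by auto
  qed
qed

end
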